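(* For all integers $n,r\ge 0$ and $\lambda\ge 1$, $$\tilde B_r^\lambda(1;n)=\sum_{k=0}^{n}\mathcal{W}_{2,r}(n,k)\,\lambda^k.$$
   Context: For integers $m\ge 1$ and $r,n,k\ge 0$, the $r$-Whitney numbers of the second kind are $$\mathcal{W}_{m,r}(n,k)=\frac{1}{m^k k!}\sum_{t=0}^{k}(-1)^t\binom{k}{t}\,[m(k-t)+r]^n,$$ with the convention $0^0=1$. For integers $n,r\ge 0$, $\lambda\ge 1$, $\tilde B_r^\lambda(1;n)$ denotes the number of configurations on $[n+r]=\{1,\dots,n+r\}$ of the following kind: the first $r$ elements form $r$ singleton blocks (the distinguishable blocks); the elements $r+1,\dots,n+r$ are partitioned into $k$ non-empty subsets, where $k$ runs over $0,\dots,n$ (all $k$ are counted); each of these $k$ subsets either is placed into one of $\lambda$ labelled sections or is paired up with one of the $r$ singletons, each singleton being paired with at most one subset; and, among the subsets placed in the same section, each subset is either paired with exactly one other subset of that section or is not paired at all (i.e. a matching on the subsets in each section). Subsets within a section are unordered. *)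

theory Defs
  imports Complex_Main "HOL-Library.FuncSet" "HOL-Library.Disjoint_Sets"
begin

text \<open>The \<open>r\<close>-Whitney numbers of the second kind (for \<open>m \<ge> 1\<close>). The natural-number
  subtraction is exact since \<open>t \<le> k\<close>.\<close>

definition whitney2 :: "nat \<Rightarrow> nat \<Rightarrow> nat \<Rightarrow> nat \<Rightarrow> real" where
  "whitney2 m r n k =
     1 / (real m ^ k * fact k) *
     (\<Sum>t=0..k. (- 1) ^ t * real (k choose t) * real (m * (k - t) + r) ^ n)"

definition dist_blocks :: "nat \<Rightarrow> nat set set" where
  "dist_blocks r = (\<lambda>i. {i}) ` {1..r}"

text \<open>A configuration is a triple \<open>(P, pl, M)\<close>. Here \<open>P\<close> is a partition of
  \<open>{1..n+r}\<close> into blocks, among them the distinguishable singletons, and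
  \<open>Q = P - dist_blocks r\<close> consists of the \<open>k\<close> subsets of \<open>{r+1..n+r}\<close>. The map \<open>pl\<close>
  sends a subset either to \<open>Inl s\<close> (placed in section \<open>s\<close>) or to \<open>Inr D\<close>
  (paired with the singleton block \<open>D\<close>); it is extensional, i.e. \<open>undefined\<close>
  outside \<open>Q\<close>, so that distinct maps are distinct configurations. \<open>M\<close> is
  the set of unordered pairs of subsets that are paired with each other within a section.\<close>

definition configs_k ::
  "nat \<Rightarrow> nat \<Rightarrow> nat \<Rightarrow> nat \<Rightarrow>
     (nat set set \<times> (nat set \<Rightarrow> nat + nat set) \<times> nat set set set) set" where
  "configs_k r l n k = {(P, pl, M).
     partition_on {1..n + r} P \<and> dist_blocks r \<subseteq> P \<and>
     (let Q = P - dist_blocks r in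
        card Q = k \<and>
        pl \<in> Q \<rightarrow>\<^sub>E {1..l} <+> dist_blocks r \<and>
        (\<forall>D\<in>dist_blocks r. \<forall>X\<in>Q. \<forall>Y\<in>Q. pl X = Inr D \<and> pl Y = Inr D \<longrightarrow> X = Y) \<and>
        M \<subseteq> {{X, Y} | X Y. X \<in> Q \<and> Y \<in> Q \<and> X \<noteq> Y \<and> (\<exists>s\<in>{1..l}. pl X = Inl s \<and> pl Y = Inl s)} \<and>
        disjoint M)}"

definition configs ::
  "nat \<Rightarrow> nat \<Rightarrow> nat \<Rightarrow>
     (nat set set \<times> (nat set \<Rightarrow> nat + nat set) \<times> nat set set set) set" where
  "configs r l n = (\<Union>k\<in>{0..n}. configs_k r l n k)"

text \<open>\<open>B_tilde r l n\<close> is $\tilde B_r^l(1;n)$.\<close>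

definition B_tilde :: "nat \<Rightarrow> nat \<Rightarrow> nat \<Rightarrow> nat" where
  "B_tilde r l n = card (configs r l n)"

end

theory Submission
  imports Defs
begin

text \<open>
  Write \<open>b\<^sub>r(n)\<close> for either side of the identity. Both sides are \<open>1\<close> at \<open>n = 0\<close>, and both satisfy
  \<open>b\<^sub>r(n + 1) = r * b\<^sub>r(n) + l * b\<^bsub>r+2\<^esub>(n)\<close>, which determines them for all \<open>r\<close> at once. In terms of
  exponential generating functions this is the differential equation \<open>F\<^sub>r' = r * F\<^sub>r + l * F\<^bsub>r+2\<^esub>\<close>
  of \<open>F\<^sub>r(t) = exp (r * t + l * (exp (2 * t) - 1) / 2)\<close>.

  The right-hand side inherits the recurrence (\<open>whitney2_poly_Suc\<close>) from
  \<open>W\<^bsub>m,r\<^esub>(n + 1, k) = r * W\<^bsub>m,r\<^esub>(n, k) + W\<^bsub>m,r+m\<^esub>(n, k - 1)\<close>: one factor \<open>m * (k - t) + r\<close> of the power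
  is split off, and \<open>k - t\<close> is absorbed by the binomial coefficient.

  For the left-hand side, fix the partition \<open>Q\<close> of \<open>{r + 1..n + r}\<close>. The number of ways to place and
  pair its blocks depends only on \<open>k = card Q\<close>. This number, \<open>num_placements l r k\<close>, satisfies a
  recurrence that comes from the three possible fates of one block: it joins a singleton, it stays
  unpaired in a section, or it is paired in a section (\<open>card_placements_insert\<close>). Hence the left-hand side
  is the sum of \<open>num_placements l r (card Q)\<close> over all partitions \<open>Q\<close> of an \<open>n\<close>-element set
  (\<open>card_configs\<close>).

  Adding one element to the ground set either creates a new singleton block or enlarges one of the
  \<open>k\<close> existing blocks, so it turns a weight \<open>f k\<close> into \<open>f (k + 1) + k * f k\<close>
  (\<open>sum_card_partition_on_insert\<close>). For \<open>f = num_placements l r\<close> the new weight is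
  \<open>r * f k + l * num_placements l (r + 2) k\<close> (\<open>num_placements_shift\<close>), and this gives the recurrence
  without any appeal to Stirling numbers.
\<close>

section \<open>The recurrence of the Whitney numbers\<close>

lemma whitney2_0: "whitney2 m r 0 k = (if k = 0 then 1 else 0)"
proof (cases "k = 0")
  case False
  then have "(\<Sum>t\<le>k. (- 1) ^ t * real (k choose t)) = 0"
    by (intro choose_alternating_sum) simp
  with False show ?thesis
    by (simp add: whitney2_def atLeast0AtMost)
qed (simp add: whitney2_def)

lemma whitney2_Suc_0: "whitney2 m r (Suc n) 0 = real r * whitney2 m r n 0"
  by (simp add: whitney2_def)

text \<open>In the factor \<open>m * (k + 1 - t) + r\<close> that is split off, the summand \<open>r\<close> reproduces the sum, and
  \<open>(k + 1 choose t) * (k + 1 - t) = (k + 1) * (k choose t)\<close> reduces the other one to the sum for \<open>k\<close>,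
  where \<open>m * (k + 1 - t) + r = m * (k - t) + (r + m)\<close> raises \<open>r\<close> by \<open>m\<close>.\<close>

lemma whitney2_Suc_Suc:
  assumes "m > 0"
  shows "whitney2 m r (Suc n) (Suc k) = real r * whitney2 m r n (Suc k) + whitney2 m (r + m) n k"
proof -
  let ?p = "\<lambda>t. real (m * (Suc k - t) + r) ^ n"
  have absorb: "(Suc k choose t) * (Suc k - t) = Suc k * (k choose t)" if "t \<le> k" for t
    using that by (metis binomial_absorb_comp diff_Suc_1 mult.commute)
  have split_power: "x * real b * real (m * d + r) ^ Suc n
      = real r * (x * real b * real (m * d + r) ^ n) + real m * (x * real (b * d) * real (m * d + r) ^ n)"
    for x :: real and b d
    by (simp add: algebra_simps)
  have "(\<Sum>t=0..Suc k. (- 1) ^ t * real (Suc k choose t) * real (m * (Suc k - t) + r) ^ Suc n)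
      = real r * (\<Sum>t=0..Suc k. (- 1) ^ t * real (Suc k choose t) * ?p t)
        + real m * (\<Sum>t=0..Suc k. (- 1) ^ t * real ((Suc k choose t) * (Suc k - t)) * ?p t)"
    by (simp only: sum_distrib_left split_power flip: sum.distrib)
  \<comment> \<open>The term for \<open>t = Suc k\<close> has the factor \<open>Suc k - t = 0\<close>.\<close>
  also have "(\<Sum>t=0..Suc k. (- 1) ^ t * real ((Suc k choose t) * (Suc k - t)) * ?p t)
      = (\<Sum>t=0..k. (- 1) ^ t * real ((Suc k choose t) * (Suc k - t)) * ?p t)"
    by (subst sum.atLeast0_atMost_Suc) simp
  also have "\<dots> = (\<Sum>t=0..k. (- 1) ^ t * real (Suc k * (k choose t)) * real (m * (k - t) + (r + m)) ^ n)"
  proof (rule sum.cong)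
    fix t assume t: "t \<in> {0..k}"
    then have "m * (Suc k - t) + r = m * (k - t) + (r + m)" by (simp add: Suc_diff_le)
    with absorb[of t] t show "(- 1) ^ t * real ((Suc k choose t) * (Suc k - t)) * ?p t
      = (- 1) ^ t * real (Suc k * (k choose t)) * real (m * (k - t) + (r + m)) ^ n" by (simp only: atLeastAtMost_iff)
  qed simp
  also have "\<dots> = real (Suc k) * (\<Sum>t=0..k. (- 1) ^ t * real (k choose t) * real (m * (k - t) + (r + m)) ^ n)"
    by (simp only: sum_distrib_left of_nat_mult mult_ac)
  finally have *: "(\<Sum>t=0..Suc k. (- 1) ^ t * real (Suc k choose t) * real (m * (Suc k - t) + r) ^ Suc n)
      = real r * (\<Sum>t=0..Suc k. (- 1) ^ t * real (Suc k choose t) * ?p t)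
        + real m * (real (Suc k) * (\<Sum>t=0..k. (- 1) ^ t * real (k choose t) * real (m * (k - t) + (r + m)) ^ n))" .
  have scale: "1 / (real m ^ Suc k * fact (Suc k)) * (real r * S + real m * (real (Suc k) * T))
      = real r * (1 / (real m ^ Suc k * fact (Suc k)) * S) + 1 / (real m ^ k * fact k) * T" for S T :: real
    using assms by (simp add: field_simps del: of_nat_Suc)
  show ?thesis
    unfolding whitney2_def * scale ..
qed

lemma whitney2_eq_0: "m > 0 \<Longrightarrow> n < k \<Longrightarrow> whitney2 m r n k = 0"
proof (induction n arbitrary: k r)
  case (Suc n)
  from \<open>Suc n < k\<close> obtain j where "k = Suc j" "n < j" by (cases k) auto
  with Suc show ?case by (simp add: whitney2_Suc_Suc)
qed (simp add: whitney2_0)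

text \<open>The shift of \<open>k\<close> in the recurrence becomes the factor \<open>x\<close>; the terms with \<open>k = n + 1\<close> that are left
  over vanish.\<close>

lemma whitney2_poly_Suc:
  assumes "m > 0"
  shows "(\<Sum>k=0..Suc n. whitney2 m r (Suc n) k * x ^ k)
    = real r * (\<Sum>k=0..n. whitney2 m r n k * x ^ k) + x * (\<Sum>k=0..n. whitney2 m (r + m) n k * x ^ k)"
proof -
  have "(\<Sum>k=0..Suc n. whitney2 m r (Suc n) k * x ^ k)
      = whitney2 m r (Suc n) 0 + (\<Sum>k=0..n. whitney2 m r (Suc n) (Suc k) * x ^ Suc k)"
    by (subst sum.atLeast0_atMost_Suc_shift) simp
  also have "\<dots> = real r * (whitney2 m r n 0 + (\<Sum>k=0..n. whitney2 m r n (Suc k) * x ^ Suc k))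
      + x * (\<Sum>k=0..n. whitney2 m (r + m) n k * x ^ k)"
    using assms
    by (simp add: whitney2_Suc_0 whitney2_Suc_Suc sum.distrib sum_distrib_left algebra_simps)
  also have "whitney2 m r n 0 + (\<Sum>k=0..n. whitney2 m r n (Suc k) * x ^ Suc k)
      = (\<Sum>k=0..Suc n. whitney2 m r n k * x ^ k)"
    by (subst sum.atLeast0_atMost_Suc_shift) simp
  also have "\<dots> = (\<Sum>k=0..n. whitney2 m r n k * x ^ k)"
    using assms by (simp add: whitney2_eq_0)
  finally show ?thesis .
qed

section \<open>Partitions with one more element\<close>

text \<open>A partition of \<open>insert a A\<close> either has \<open>{a}\<close> as a block or arises from a unique partition of \<open>A\<close> with
  a marked block, by adding \<open>a\<close> to that block. Stating this for an arbitrary weight \<open>f\<close> makes it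
  possible to iterate the step, since the right-hand side is again a sum of the same form.\<close>

lemma sum_card_partition_on_insert:
  fixes f :: "nat \<Rightarrow> 'b::comm_semiring_1"
  assumes "finite A" "a \<notin> A"
  shows "(\<Sum>P | partition_on (insert a A) P. f (card P))
    = (\<Sum>P | partition_on A P. f (Suc (card P)) + of_nat (card P) * f (card P))"
proof -
  define Parts where "Parts = {P. partition_on A P}"
  define S1 where "S1 = insert {a} ` Parts"
  define ext where "ext = (\<lambda>(P, X). insert (insert a X) (P - {X}))"
  define S2 where "S2 = ext ` (SIGMA P:Parts. P)"
  have fin: "finite Parts"
    unfolding Parts_def using assms(1) by (rule finitely_many_partition_on)
  have finP: "finite P" if "P \<in> Parts" for P
    using that assms(1) finite_elements by (auto simp: Parts_def)
  have a_notin: "a \<notin> X" if "P \<in> Parts" "X \<in> P" for P X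
    using that assms(2) by (auto simp: Parts_def partition_on_def)
  have ne: "X \<noteq> {}" if "P \<in> Parts" "X \<in> P" for P X
    using that by (auto simp: Parts_def partition_on_def)
  have rest: "partition_on (A - X) (P - {X})" if "P \<in> Parts" "X \<in> P" for P X
  proof -
    have "disjnt X (\<Union>(P - {X}))"
      using that by (auto simp: Parts_def partition_on_def disjoint_def disjnt_def)
    with that show ?thesis
      using partition_on_insert[of X "P - {X}" A] by (simp add: Parts_def insert_absorb)
  qed
  have "{P. partition_on (insert a A) P} = S1 \<union> S2"
  proof (intro set_eqI iffI)
    fix P assume "P \<in> {P. partition_on (insert a A) P}"
    then have P: "partition_on (insert a A) P" by simp
    then obtain X where X: "X \<in> P" "a \<in> X" by (auto simp: partition_on_def)
    define P' where "P' = P - {X}"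
    have PX: "P = insert X P'" using X by (auto simp: P'_def)
    have d: "disjnt X (\<Union>P')"
      using P X by (auto simp: P'_def partition_on_def disjoint_def disjnt_def)
    have P': "partition_on (insert a A - X) P'" "X \<subseteq> insert a A"
      using P d unfolding PX by (simp_all add: partition_on_insert)
    show "P \<in> S1 \<union> S2"
    proof (cases "X = {a}")
      case True
      then have "P' \<in> Parts" using P' assms(2) by (simp add: Parts_def)
      then show ?thesis by (auto simp: S1_def PX True)
    next
      case False
      define Y where "Y = X - {a}"
      have Y: "Y \<noteq> {}" "Y \<subseteq> A" "X = insert a Y" "a \<notin> Y"
        using False X P'(2) by (auto simp: Y_def)
      have "insert a A - X = A - Y" using Y assms(2) by auto
      then have "partition_on A (insert Y P')"
        using P' d Y by (subst partition_on_insert) (auto simp: disjnt_def)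
      moreover have "Y \<notin> P'" using d Y by (auto simp: disjnt_def)
      ultimately have "(insert Y P', Y) \<in> (SIGMA P:Parts. P)" "ext (insert Y P', Y) = P"
        using Y by (auto simp: Parts_def ext_def PX)
      then show ?thesis unfolding S2_def by (metis UnCI image_eqI)
    qed
  next
    fix P assume "P \<in> S1 \<union> S2"
    then show "P \<in> {P. partition_on (insert a A) P}"
    proof
      assume "P \<in> S1"
      then obtain P' where "P' \<in> Parts" and P: "P = insert {a} P'" by (auto simp: S1_def)
      then have "partition_on A P'" by (simp add: Parts_def)
      then show ?thesis using assms(2) unfolding P
        by (simp, subst partition_on_insert) (auto simp: partition_on_def disjnt_def)
    next
      assume "P \<in> S2"
      then obtain P' X where P': "P' \<in> Parts" "X \<in> P'" and P: "P = insert (insert a X) (P' - {X})"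
        by (auto simp: S2_def ext_def)
      have r: "partition_on (A - X) (P' - {X})" by (rule rest[OF P'])
      have "insert a A - insert a X = A - X" using assms(2) by auto
      moreover have "X \<subseteq> A" using P' by (auto simp: Parts_def partition_on_def)
      ultimately show ?thesis using r assms(2) unfolding P
        by (simp, subst partition_on_insert) (auto simp: partition_on_def disjnt_def)
    qed
  qed
  moreover have "S1 \<inter> S2 = {}"
  proof -
    have "{a} \<notin> ext (P, X)" if "P \<in> Parts" "X \<in> P" for P X
      using a_notin[of P] ne[OF that] a_notin[OF that] that by (auto simp: ext_def)
    then show ?thesis by (auto simp: S1_def S2_def)
  qed
  moreover have "(\<Sum>P\<in>S1. f (card P)) = (\<Sum>P\<in>Parts. f (Suc (card P)))"
  proof -
    have n: "{a} \<notin> P" if "P \<in> Parts" for P using a_notin[OF that] by auto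
    then have "inj_on (insert {a}) Parts"
      by (intro inj_onI) (metis insert_ident)
    then show ?thesis unfolding S1_def
      using n finP by (simp add: sum.reindex)
  qed
  moreover have "(\<Sum>P\<in>S2. f (card P)) = (\<Sum>P\<in>Parts. of_nat (card P) * f (card P))"
  proof -
    have "inj_on ext (SIGMA P:Parts. P)"
    proof (rule inj_onI)
      fix u v assume u: "u \<in> (SIGMA P:Parts. P)" and v: "v \<in> (SIGMA P:Parts. P)" and e: "ext u = ext v"
      obtain P X P' X' where uv: "u = (P, X)" "v = (P', X')" by (metis surj_pair)
      \<comment> \<open>The block of \<open>a\<close> reveals the marked block \<open>X\<close>; the other blocks together with \<open>X\<close> then give \<open>P\<close>.\<close>
      have *: "{Z \<in> ext (P, X). a \<in> Z} = {insert a X}" if "P \<in> Parts" for P X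
        using a_notin[OF that] by (auto simp: ext_def)
      have "insert a X = insert a X'"
        using *[of P X] *[of P' X'] e u v by (simp add: uv)
      then have X: "X = X'"
        using a_notin[of P X] a_notin[of P' X'] u v by (simp add: uv insert_ident)
      have **: "P = insert X {Z \<in> ext (P, X). a \<notin> Z}" if "P \<in> Parts" "X \<in> P" for P X
        using that a_notin[OF that(1)] by (auto simp: ext_def)
      have "P = P'"
        using **[of P X] **[of P' X'] e u v X by (simp add: uv)
      with X show "u = v" by (simp add: uv)
    qed
    moreover have "card (ext (P, X)) = card P" if "P \<in> Parts" "X \<in> P" for P X
    proof -
      have "insert a X \<notin> P - {X}" using a_notin[OF that(1)] by auto
      then show ?thesis using finP[OF that(1)] that(2) card_Suc_Diff1[of P X] by (simp add: ext_def)
    qed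
    ultimately have "(\<Sum>P\<in>S2. f (card P)) = (\<Sum>(P, X)\<in>(SIGMA P:Parts. P). f (card P))"
      unfolding S2_def by (auto simp: sum.reindex intro!: sum.cong)
    also have "\<dots> = (\<Sum>P\<in>Parts. \<Sum>X\<in>P. f (card P))"
      using fin finP by (subst sum.Sigma) auto
    finally show ?thesis by simp
  qed
  moreover have "finite S1" "finite S2"
    using fin finP by (auto simp: S1_def S2_def)
  ultimately show ?thesis
    by (simp add: sum.union_disjoint sum.distrib Parts_def)
qed

section \<open>Placing and pairing the blocks of a partition\<close>

definition section_pairs :: "'a set \<Rightarrow> 'b set \<Rightarrow> ('a \<Rightarrow> 'b + 'c) \<Rightarrow> 'a set set" where
  "section_pairs Q L pl =
     {{X, Y} | X Y. X \<in> Q \<and> Y \<in> Q \<and> X \<noteq> Y \<and> (\<exists>s\<in>L. pl X = Inl s \<and> pl Y = Inl s)}"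

text \<open>The pairs \<open>(pl, M)\<close> that complete a partition with set of blocks \<open>Q\<close> to a configuration. Here \<open>Q\<close>,
  the set \<open>L\<close> of sections and the set \<open>S\<close> of singletons are arbitrary, so that a block or a singleton
  can be removed in an induction.\<close>

definition placements ::
  "'a set \<Rightarrow> 'b set \<Rightarrow> 'c set \<Rightarrow> (('a \<Rightarrow> 'b + 'c) \<times> 'a set set) set" where
  "placements Q L S = {(pl, M).
     pl \<in> Q \<rightarrow>\<^sub>E L <+> S \<and>
     (\<forall>D\<in>S. \<forall>X\<in>Q. \<forall>Y\<in>Q. pl X = Inr D \<and> pl Y = Inr D \<longrightarrow> X = Y) \<and>
     M \<subseteq> section_pairs Q L pl \<and> disjoint M}"

text \<open>Whether \<open>e\<close> is an admissible pair depends on \<open>pl\<close> only through its values on \<open>e\<close>. This is what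
  carries a matching over when blocks are added or removed and \<open>pl\<close> is changed elsewhere.\<close>

lemma section_pairs_transfer:
  assumes "e \<in> section_pairs Q L pl" "e \<subseteq> Q'" "\<And>X. X \<in> e \<Longrightarrow> pl' X = pl X"
  shows "e \<in> section_pairs Q' L pl'"
proof -
  from assms(1) obtain X Y s where "e = {X, Y}" "X \<noteq> Y" "s \<in> L" "pl X = Inl s" "pl Y = Inl s"
    by (auto simp: section_pairs_def)
  moreover from this have "X \<in> Q'" "Y \<in> Q'" "pl' X = Inl s" "pl' Y = Inl s" using assms(2,3) by auto
  ultimately show ?thesis unfolding section_pairs_def by blast
qed

lemma section_pairs_subset: "e \<in> section_pairs Q L pl \<Longrightarrow> e \<subseteq> Q"
  by (auto simp: section_pairs_def)

lemma placements_empty: "placements {} L S = {(\<lambda>_. undefined, {})}"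
  by (auto simp: placements_def section_pairs_def)

lemma placementsI:
  assumes "pl \<in> Q \<rightarrow>\<^sub>E L <+> S"
    and "\<And>D X Y. D \<in> S \<Longrightarrow> X \<in> Q \<Longrightarrow> Y \<in> Q \<Longrightarrow> pl X = Inr D \<Longrightarrow> pl Y = Inr D \<Longrightarrow> X = Y"
    and "\<And>e. e \<in> M \<Longrightarrow> e \<in> section_pairs Q L pl" and "disjoint M"
  shows "(pl, M) \<in> placements Q L S"
  using assms unfolding placements_def by blast

lemma placementsD:
  assumes "(pl, M) \<in> placements Q L S"
  shows "pl \<in> Q \<rightarrow>\<^sub>E L <+> S"
    and "D \<in> S \<Longrightarrow> X \<in> Q \<Longrightarrow> Y \<in> Q \<Longrightarrow> pl X = Inr D \<Longrightarrow> pl Y = Inr D \<Longrightarrow> X = Y"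
    and "e \<in> M \<Longrightarrow> e \<in> section_pairs Q L pl" and "disjoint M" and "e \<in> M \<Longrightarrow> e \<subseteq> Q"
  using assms section_pairs_subset[of e Q L pl] unfolding placements_def by blast+

lemma finite_placements: "finite Q \<Longrightarrow> finite L \<Longrightarrow> finite S \<Longrightarrow> finite (placements Q L S)"
  by (rule finite_subset[of _ "(Q \<rightarrow>\<^sub>E L <+> S) \<times> Pow (Pow Q)"])
     (auto simp: placements_def section_pairs_def intro!: finite_PiE)

text \<open>An extensional function is determined by any of its updates at a point outside its domain; hence the
  injectivity of the maps that extend a placement to a new block.\<close>

lemma PiE_fun_upd_eqD:
  assumes "f \<in> A \<rightarrow>\<^sub>E B" "g \<in> A \<rightarrow>\<^sub>E B'" "x \<notin> A" "f(x := u) = g(x := v)"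
  shows "f = g"
proof
  fix y show "f y = g y"
  proof (cases "y = x")
    case True
    then show ?thesis using PiE_arb[OF assms(1,3)] PiE_arb[OF assms(2,3)] by simp
  next
    case False
    then show ?thesis using fun_cong[OF assms(4), of y] by simp
  qed
qed

lemma PiE_remove:
  assumes "f \<in> A \<rightarrow>\<^sub>E B" "A' = A - {x}" "\<And>y. y \<in> A' \<Longrightarrow> f y \<in> B'"
  shows "f(x := undefined) \<in> A' \<rightarrow>\<^sub>E B'"
  using assms by (auto simp: PiE_def extensional_def)

context
  fixes Q :: "'a set" and L :: "'b set" and S :: "'c set" and q :: 'a
  assumes fin: "finite Q" "finite L" "finite S" and q: "q \<notin> Q"
begin

text \<open>The three fates of a new block \<open>q\<close>: it joins a singleton \<open>D\<close>, which is then lost to the other blocks;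
  it lies unpaired in a section \<open>s\<close>; or it is paired with a block \<open>y\<close> in section \<open>s\<close>. In the last case
  \<open>y\<close> is removed as well, because \<open>y\<close> has no freedom left.\<close>

definition via_singleton where
  "via_singleton = (\<lambda>(D, pl, M). (pl(q := Inr D), M)) ` (SIGMA D:S. placements Q L (S - {D}))"

definition via_unpaired where
  "via_unpaired = (\<lambda>(s, pl, M). (pl(q := Inl s), M)) ` (L \<times> placements Q L S)"

definition via_pair where
  "via_pair = (\<lambda>((s, y), pl, M). (pl(y := Inl s, q := Inl s), insert {q, y} M)) `
     (SIGMA (s, y):L \<times> Q. placements (Q - {y}) L S)"

lemma placements_insert_subset:
  "placements (insert q Q) L S \<subseteq> via_singleton \<union> via_unpaired \<union> via_pair"
proof
  fix c assume c: "c \<in> placements (insert q Q) L S"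
  obtain pl M where pM: "c = (pl, M)" by force
  note c = placementsD[OF c[unfolded pM]]
  have plQ: "pl X \<in> L <+> S" if "X \<in> insert q Q" for X using c(1) that by blast
  define pl' where "pl' = pl(q := undefined)"
  have pl'Q: "pl' X = pl X" if "X \<in> Q" for X using that q by (auto simp: pl'_def)
  have pl'_PiE: "pl' \<in> Q \<rightarrow>\<^sub>E B" if "\<And>X. X \<in> Q \<Longrightarrow> pl X \<in> B" for B
    unfolding pl'_def by (rule PiE_remove[OF c(1)]) (use q that in auto)
  show "c \<in> via_singleton \<union> via_unpaired \<union> via_pair"
  proof (cases "pl q")
    case (Inr D)
    then have D: "D \<in> S" using plQ[of q] by auto
    have ne: "pl X \<noteq> Inr D" if "X \<in> Q" for X using c(2)[OF D, of X q] that q Inr by auto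
    have "(pl', M) \<in> placements Q L (S - {D})"
    proof (rule placementsI)
      show "pl' \<in> Q \<rightarrow>\<^sub>E L <+> (S - {D})"
      proof (rule pl'_PiE)
        fix X assume "X \<in> Q"
        then show "pl X \<in> L <+> (S - {D})" using plQ[of X] ne[of X] by auto
      qed
    next
      fix e assume e: "e \<in> M"
      then have "q \<notin> e" using c(3)[OF e] Inr by (auto simp: section_pairs_def)
      then have "e \<subseteq> Q" using c(5)[OF e] by blast
      then show "e \<in> section_pairs Q L pl'"
        using section_pairs_transfer[OF c(3)[OF e]] pl'Q by blast
    qed (use c(2,4) pl'Q in auto)
    moreover have "pl = pl'(q := Inr D)" using Inr by (auto simp: pl'_def)
    ultimately have "c \<in> via_singleton" using D
      unfolding pM via_singleton_def by (intro image_eqI[of _ _ "(D, pl', M)"]) auto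
    then show ?thesis by blast
  next
    case (Inl s)
    then have s: "s \<in> L" using plQ[of q] by auto
    show ?thesis
    proof (cases "q \<in> \<Union>M")
      case False
      have "(pl', M) \<in> placements Q L S"
      proof (rule placementsI)
        show "pl' \<in> Q \<rightarrow>\<^sub>E L <+> S" using plQ by (intro pl'_PiE) auto
      next
        fix e assume e: "e \<in> M"
        then have "e \<subseteq> Q" using c(5)[OF e] False by blast
        then show "e \<in> section_pairs Q L pl'"
          using section_pairs_transfer[OF c(3)[OF e]] pl'Q by blast
      qed (use c(2,4) pl'Q in auto)
      moreover have "pl = pl'(q := Inl s)" using Inl by (auto simp: pl'_def)
      ultimately have "c \<in> via_unpaired" using s
        unfolding pM via_unpaired_def by (intro image_eqI[of _ _ "(s, pl', M)"]) auto
      then show ?thesis by blast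
    next
      case True
      then obtain e where e: "e \<in> M" "q \<in> e" by blast
      from c(3)[OF e(1)] obtain X Y u where XY: "e = {X, Y}" "X \<in> insert q Q" "Y \<in> insert q Q"
          "X \<noteq> Y" "pl X = Inl u" "pl Y = Inl u"
        by (auto simp: section_pairs_def)
      obtain y where y: "e = {q, y}" "y \<in> Q" "pl y = Inl s"
      proof (cases "q = X")
        case True
        with XY Inl show ?thesis by (intro that[of Y]) auto
      next
        case False
        with XY Inl e(2) show ?thesis by (intro that[of X]) auto
      qed
      \<comment> \<open>The remaining pairs avoid both \<open>q\<close> and \<open>y\<close> because \<open>M\<close> is disjoint.\<close>
      define N where "N = M - {e}"
      define pl'' where "pl'' = pl'(y := undefined)"
      have pl''Q: "pl'' X = pl X" if "X \<in> Q - {y}" for X using that pl'Q by (auto simp: pl''_def)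
      have "(pl'', N) \<in> placements (Q - {y}) L S"
      proof (rule placementsI)
        have "pl' \<in> Q \<rightarrow>\<^sub>E L <+> S" using plQ by (intro pl'_PiE) auto
        then show "pl'' \<in> Q - {y} \<rightarrow>\<^sub>E L <+> S"
          unfolding pl''_def by (rule PiE_remove) (use plQ pl'Q in auto)
      next
        fix e' assume "e' \<in> N"
        then have e': "e' \<in> M" "e' \<inter> e = {}"
          using disjointD[OF c(4), of e' e] e(1) by (auto simp: N_def)
        then have "e' \<subseteq> Q - {y}" using c(5)[OF e'(1)] y(1) by blast
        then show "e' \<in> section_pairs (Q - {y}) L pl''"
          using section_pairs_transfer[OF c(3)[OF e'(1)]] pl''Q by blast
      next
        show "disjoint N" using c(4) by (auto simp: N_def disjoint_def)
      qed (use c(2) pl''Q in auto)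
      moreover have "pl = pl''(y := Inl s, q := Inl s)"
        using Inl y(3) by (auto simp: pl''_def pl'_def)
      moreover have "M = insert {q, y} N" using e y(1) by (auto simp: N_def)
      ultimately have "c \<in> via_pair" using s y(2)
        unfolding pM via_pair_def by (intro image_eqI[of _ _ "((s, y), pl'', N)"]) auto
      then show ?thesis by blast
    qed
  qed
qed

lemma via_singleton_subset: "via_singleton \<subseteq> placements (insert q Q) L S"
proof
  fix c assume "c \<in> via_singleton"
  then obtain D pl M where c: "c = (pl(q := Inr D), M)" "D \<in> S" "(pl, M) \<in> placements Q L (S - {D})"
    by (auto simp: via_singleton_def)
  note p = placementsD[OF c(3)]
  have neD: "pl X \<noteq> Inr D" if "X \<in> Q" for X
    using PiE_mem[OF p(1) that] by auto
  have "pl \<in> Q \<rightarrow>\<^sub>E L <+> S" using p(1) by (auto simp: PiE_def Pi_def)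
  then have "pl(q := Inr D) \<in> insert q Q \<rightarrow>\<^sub>E L <+> S" using c(2) by (intro PiE_fun_upd) auto
  moreover have "X = Y"
    if "D' \<in> S" "X \<in> insert q Q" "Y \<in> insert q Q" "(pl(q := Inr D)) X = Inr D'" "(pl(q := Inr D)) Y = Inr D'"
    for D' X Y
    using that p(2)[of D' X Y] neD by (auto split: if_splits)
  moreover have "e \<in> section_pairs (insert q Q) L (pl(q := Inr D))" if "e \<in> M" for e
    by (rule section_pairs_transfer[OF p(3)[OF that]]) (use p(5)[OF that] q in auto)
  ultimately show "c \<in> placements (insert q Q) L S"
    unfolding c(1) using p(4) by (intro placementsI)
qed

lemma via_unpaired_subset: "via_unpaired \<subseteq> placements (insert q Q) L S"
proof
  fix c assume "c \<in> via_unpaired"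
  then obtain s pl M where c: "c = (pl(q := Inl s), M)" "s \<in> L" "(pl, M) \<in> placements Q L S"
    by (auto simp: via_unpaired_def)
  note p = placementsD[OF c(3)]
  have "pl(q := Inl s) \<in> insert q Q \<rightarrow>\<^sub>E L <+> S" using c(2) p(1) by (intro PiE_fun_upd) auto
  moreover have "X = Y"
    if "D' \<in> S" "X \<in> insert q Q" "Y \<in> insert q Q" "(pl(q := Inl s)) X = Inr D'" "(pl(q := Inl s)) Y = Inr D'"
    for D' X Y
    using that p(2)[of D' X Y] by (auto split: if_splits)
  moreover have "e \<in> section_pairs (insert q Q) L (pl(q := Inl s))" if "e \<in> M" for e
    by (rule section_pairs_transfer[OF p(3)[OF that]]) (use p(5)[OF that] q in auto)
  ultimately show "c \<in> placements (insert q Q) L S"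
    unfolding c(1) using p(4) by (intro placementsI)
qed

lemma via_pair_subset: "via_pair \<subseteq> placements (insert q Q) L S"
proof
  fix c assume "c \<in> via_pair"
  then obtain s y pl M where c: "c = (pl(y := Inl s, q := Inl s), insert {q, y} M)" "s \<in> L" "y \<in> Q"
      "(pl, M) \<in> placements (Q - {y}) L S"
    by (auto simp: via_pair_def)
  define pl' where "pl' = pl(y := Inl s, q := Inl s)"
  note p = placementsD[OF c(4)]
  have "pl' \<in> insert q (insert y (Q - {y})) \<rightarrow>\<^sub>E L <+> S"
    unfolding pl'_def using c(2) p(1) by (intro PiE_fun_upd) auto
  then have "pl' \<in> insert q Q \<rightarrow>\<^sub>E L <+> S" using c(3) by (simp add: insert_absorb)
  moreover have "X = Y"
    if "D' \<in> S" "X \<in> insert q Q" "Y \<in> insert q Q" "pl' X = Inr D'" "pl' Y = Inr D'"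
    for D' X Y
    using that p(2)[of D' X Y] by (auto simp: pl'_def split: if_splits)
  moreover have "e \<in> section_pairs (insert q Q) L pl'" if "e \<in> insert {q, y} M" for e
  proof (cases "e = {q, y}")
    case True
    have "q \<noteq> y" "pl' q = Inl s" "pl' y = Inl s" using q c(3) by (auto simp: pl'_def)
    then show ?thesis unfolding section_pairs_def True using c(2,3) by blast
  next
    case False
    then have e: "e \<in> M" using that by simp
    show ?thesis
      by (rule section_pairs_transfer[OF p(3)[OF e]]) (use p(5)[OF e] q in \<open>auto simp: pl'_def\<close>)
  qed
  moreover have "disjoint (insert {q, y} M)"
    using p(4,5) q by (fastforce simp: disjoint_def)
  ultimately show "c \<in> placements (insert q Q) L S"
    unfolding c(1) pl'_def[symmetric] by (intro placementsI)
qed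

lemma card_via_singleton: "card via_singleton = (\<Sum>D\<in>S. card (placements Q L (S - {D})))"
proof -
  have "inj_on (\<lambda>(D, pl, M). (pl(q := Inr D), M)) (SIGMA D:S. placements Q L (S - {D}))"
    by (rule inj_onI)
      (auto dest: placementsD(1) fun_cong[of _ _ q] intro: PiE_fun_upd_eqD[OF _ _ q])
  then show ?thesis unfolding via_singleton_def
    using fin by (simp add: card_image finite_placements)
qed

lemma card_via_unpaired: "card via_unpaired = card L * card (placements Q L S)"
proof -
  have "inj_on (\<lambda>(s, pl, M). (pl(q := Inl s), M)) (L \<times> placements Q L S)"
    by (rule inj_onI)
      (auto dest: placementsD(1) fun_cong[of _ _ q] intro: PiE_fun_upd_eqD[OF _ _ q])
  then show ?thesis unfolding via_unpaired_def
    by (simp add: card_image card_cartesian_product)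
qed

lemma card_via_pair: "card via_pair = card L * (\<Sum>y\<in>Q. card (placements (Q - {y}) L S))"
proof -
  have "inj_on (\<lambda>((s, y), pl, M). (pl(y := Inl s, q := Inl s), insert {q, y} M))
      (SIGMA (s, y):L \<times> Q. placements (Q - {y}) L S)"
  proof (rule inj_onI, clarsimp)
    fix s y pl M s' y' pl' M'
    assume y: "y \<in> Q" "y' \<in> Q"
      and m: "(pl, M) \<in> placements (Q - {y}) L S" "(pl', M') \<in> placements (Q - {y'}) L S"
      and e: "pl(y := Inl s, q := Inl s) = pl'(y' := Inl s', q := Inl s')"
      and eM: "insert {q, y} M = insert {q, y'} M'"
    have s: "s = s'" using fun_cong[OF e, of q] by simp
    have sub: "e \<subseteq> Q" if "e \<in> M \<union> M'" for e
      using placementsD(5)[OF m(1)] placementsD(5)[OF m(2)] that by blast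
    \<comment> \<open>No pair of \<open>M\<close> or \<open>M'\<close> contains \<open>q\<close>, so the pair containing \<open>q\<close> reveals \<open>y\<close>.\<close>
    have "{q, y} \<in> insert {q, y'} M'" using eM by blast
    then have "{q, y} = {q, y'}" using sub q by blast
    then have yy: "y = y'" by (auto simp: doubleton_eq_iff)
    have "{q, y} \<notin> M" "{q, y'} \<notin> M'" using sub q by blast+
    then have M: "M = M'" using eM yy by (simp add: insert_ident)
    have PiE: "pl \<in> Q - {y} \<rightarrow>\<^sub>E L <+> S" "pl' \<in> Q - {y} \<rightarrow>\<^sub>E L <+> S"
      using m yy by (auto dest: placementsD(1))
    then have "pl(y := Inl s) \<in> insert y (Q - {y}) \<rightarrow>\<^sub>E insert (Inl s) (L <+> S)"
      "pl'(y := Inl s) \<in> insert y (Q - {y}) \<rightarrow>\<^sub>E insert (Inl s) (L <+> S)"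
      by (auto simp: PiE_def Pi_def extensional_def)
    then have "pl(y := Inl s) = pl'(y := Inl s)"
      by (rule PiE_fun_upd_eqD[where x = q]) (use q y e s yy in auto)
    then have "pl = pl'"
      by (rule PiE_fun_upd_eqD[where x = y, rotated 3]) (use PiE in auto)
    with s yy M show "s = s' \<and> y = y' \<and> pl = pl' \<and> M = M'" by simp
  qed
  then have "card via_pair = (\<Sum>(s, y)\<in>L \<times> Q. card (placements (Q - {y}) L S))"
    unfolding via_pair_def using fin
    by (simp add: card_image finite_placements split_def)
  also have "\<dots> = (\<Sum>s\<in>L. \<Sum>y\<in>Q. card (placements (Q - {y}) L S))"
    by (rule sum.cartesian_product[symmetric])
  finally show ?thesis by simp
qed

text \<open>The fate of \<open>q\<close> can be read off from \<open>pl q\<close> and from whether some pair in \<open>M\<close> contains \<open>q\<close>.\<close>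

lemma via_disjoint:
  "via_singleton \<inter> via_unpaired = {}" "via_singleton \<inter> via_pair = {}" "via_unpaired \<inter> via_pair = {}"
proof -
  have 1: "\<exists>D. pl q = Inr D" if "(pl, M) \<in> via_singleton" for pl M
    using that by (auto simp: via_singleton_def)
  have 2: "(\<exists>s. pl q = Inl s) \<and> q \<notin> \<Union>M" if "(pl, M) \<in> via_unpaired" for pl M
    using that q by (auto simp: via_unpaired_def dest: placementsD(5))
  have 3: "(\<exists>s. pl q = Inl s) \<and> q \<in> \<Union>M" if "(pl, M) \<in> via_pair" for pl M
    using that by (auto simp: via_pair_def)
  show "via_singleton \<inter> via_unpaired = {}" using 1 2 by fastforce
  show "via_singleton \<inter> via_pair = {}" using 1 3 by fastforce
  show "via_unpaired \<inter> via_pair = {}" using 2 3 by fastforce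
qed

lemma card_placements_insert:
  "card (placements (insert q Q) L S) = (\<Sum>D\<in>S. card (placements Q L (S - {D})))
     + card L * card (placements Q L S) + card L * (\<Sum>y\<in>Q. card (placements (Q - {y}) L S))"
proof -
  have eq: "placements (insert q Q) L S = via_singleton \<union> via_unpaired \<union> via_pair"
    using placements_insert_subset via_singleton_subset via_unpaired_subset via_pair_subset by blast
  have "finite (placements (insert q Q) L S)" using fin by (simp add: finite_placements)
  then have f: "finite via_singleton" "finite via_unpaired" "finite via_pair" by (simp_all add: eq)
  show ?thesis
    unfolding eq card_via_singleton[symmetric] card_via_unpaired[symmetric] card_via_pair[symmetric]
    using f via_disjoint by (simp add: card_Un_disjoint Int_Un_distrib2)
qed

end

section \<open>The number of placements\<close>

text \<open>The recurrence of \<open>card_placements_insert\<close> in terms of cardinalities. The truncated differences are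
  harmless: for \<open>r = 0\<close> or \<open>k = 0\<close> they come with the factor \<open>0\<close>. The exponential generating function
  in \<open>k\<close> is \<open>(1 + x) ^ r * exp (l * (x + x\<^sup>2 / 2))\<close>.\<close>

fun num_placements :: "nat \<Rightarrow> nat \<Rightarrow> nat \<Rightarrow> nat" where
  "num_placements l r 0 = 1"
| "num_placements l r (Suc k) = r * num_placements l (r - 1) k + l * num_placements l r k + l * k * num_placements l r (k - 1)"

lemma card_placements:
  assumes "finite Q" "finite L" "finite S"
  shows "card (placements Q L S) = num_placements (card L) (card S) (card Q)"
  using assms(1,3)
proof (induction "card Q" arbitrary: Q S rule: less_induct)
  case less
  show ?case
  proof (cases "Q = {}")
    case False
    then obtain q Q' where Q: "Q = insert q Q'" "q \<notin> Q'" by (meson Set.set_insert ex_in_conv)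
    have Q': "finite Q'" "card Q = Suc (card Q')" using less.prems Q by auto
    have "card (placements Q' L (S - {D})) = num_placements (card L) (card S - 1) (card Q')" if "D \<in> S" for D
      using less.hyps[of Q' "S - {D}"] less.prems Q' that by simp
    moreover have "card (placements (Q' - {y}) L S) = num_placements (card L) (card S) (card Q' - 1)" if "y \<in> Q'" for y
      using less.hyps[of "Q' - {y}" S] less.prems Q' that by simp
    moreover have "card (placements Q' L S) = num_placements (card L) (card S) (card Q')"
      using less.hyps[of Q' S] less.prems Q' by simp
    ultimately show ?thesis
      using card_placements_insert[OF Q'(1) assms(2) less.prems(2) Q(2)] Q' by (simp add: Q(1))
  qed (simp add: placements_empty)
qed

text \<open>A further singleton is either left alone or joined by one of the \<open>k\<close> blocks. The proof verifies this
  from the recurrence; on generating functions it is the multiplication by \<open>1 + x\<close>.\<close>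

lemma num_placements_Suc_singleton: "num_placements l (Suc r) k = num_placements l r k + k * num_placements l r (k - 1)"
proof (induction k arbitrary: r rule: less_induct)
  case (less k)
  show ?case
  proof (cases k)
    case (Suc j)
    have key: "r * num_placements l r j + l * j * num_placements l r (j - 1) + l * j * (j - 1) * num_placements l r (j - 1 - 1)
        = r * num_placements l (r - 1) j + j * num_placements l r j"
    proof (cases j)
      case (Suc i)
      have "r * num_placements l r j = r * (num_placements l (r - 1) j + j * num_placements l (r - 1) (j - 1))"
        using less.IH[of j "r - 1"] \<open>k = Suc j\<close> by (cases r) simp_all
      then show ?thesis by (simp add: Suc algebra_simps)
    qed simp
    have "num_placements l (Suc r) k = Suc r * num_placements l r j + l * num_placements l (Suc r) j + l * j * num_placements l (Suc r) (j - 1)"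
      by (simp add: Suc)
    also have "\<dots> = Suc r * num_placements l r j + l * (num_placements l r j + j * num_placements l r (j - 1))
        + l * j * (num_placements l r (j - 1) + (j - 1) * num_placements l r (j - 1 - 1))"
      using less.IH[of j r] less.IH[of "j - 1" r] Suc by simp
    also have "\<dots> = (r * num_placements l r j + l * j * num_placements l r (j - 1) + l * j * (j - 1) * num_placements l r (j - 1 - 1))
        + (num_placements l r j + l * num_placements l r j + l * j * num_placements l r (j - 1))"
      by (simp add: algebra_simps)
    also have "\<dots> = num_placements l r k + k * num_placements l r (k - 1)"
      unfolding key by (simp add: Suc algebra_simps)
    finally show ?thesis .
  qed simp
qed

text \<open>On generating functions, with \<open>A\<^sub>r(x) = (1 + x) ^ r * exp (l * (x + x\<^sup>2 / 2))\<close>, this is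
  \<open>(1 + x) * A\<^sub>r' = r * A\<^sub>r + l * A\<^bsub>r+2\<^esub>\<close>. The derivative
  of the exponent contributes \<open>l * (1 + x)\<close>; with the prefactor \<open>1 + x\<close> this turns \<open>A\<^sub>r\<close> into
  \<open>l * A\<^bsub>r+2\<^esub>\<close>.\<close>

lemma num_placements_shift:
  "num_placements l r (Suc k) + k * num_placements l r k = r * num_placements l r k + l * num_placements l (r + 2) k"
proof -
  have r: "r * num_placements l r k = r * num_placements l (r - 1) k + r * (k * num_placements l (r - 1) (k - 1))"
    using num_placements_Suc_singleton[of l "r - 1" k] by (cases r) (simp_all add: algebra_simps)
  have "num_placements l (r + 2) k = num_placements l (Suc r) k + k * num_placements l (Suc r) (k - 1)"
    using num_placements_Suc_singleton[of l "Suc r" k] by simp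
  also have "\<dots> = num_placements l r k + 2 * k * num_placements l r (k - 1) + k * (k - 1) * num_placements l r (k - 1 - 1)"
    by (cases k) (simp_all add: num_placements_Suc_singleton algebra_simps del: num_placements.simps)
  finally have r2: "num_placements l (r + 2) k = \<dots>" .
  have k: "k * num_placements l r k = k * (r * num_placements l (r - 1) (k - 1) + l * num_placements l r (k - 1)
     + l * (k - 1) * num_placements l r (k - 1 - 1))"
    by (cases k) simp_all
  show ?thesis unfolding r2 r num_placements.simps
    by (subst k) (cases k; simp add: algebra_simps del: num_placements.simps)
qed
section \<open>Counting configurations\<close>

text \<open>Removing the \<open>r\<close> distinguishable blocks identifies the partitions that contain them with the
  partitions of \<open>{r + 1..n + r}\<close>. The bound \<open>k \<le> n\<close> in the definition of a configuration always holds,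
  because the \<open>k\<close> blocks are non-empty and disjoint.\<close>

lemma card_configs:
  "card (configs r l n) = (\<Sum>Q | partition_on {Suc r..n + r} Q. num_placements l r (card Q))"
proof -
  define E where "E = dist_blocks r"
  have E: "card E = r" "finite E" "partition_on {1..r} E"
    unfolding E_def dist_blocks_def by (simp_all add: card_image partition_on_singletons)
  define Parts where "Parts = {Q. partition_on {Suc r..n + r} Q}"
  have fin: "finite Parts" unfolding Parts_def by (rule finitely_many_partition_on) simp
  have finQ: "finite Q" if "Q \<in> Parts" for Q
    using that finite_elements by (auto simp: Parts_def)
  have Q_E: "Q \<inter> E = {}" if "Q \<in> Parts" for Q
  proof -
    have "X \<notin> Q" if "X \<in> E" for X
    proof
      assume "X \<in> Q"
      then have "X \<subseteq> {Suc r..n + r}" using \<open>Q \<in> Parts\<close> by (auto simp: Parts_def partition_on_def)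
      moreover have "X \<subseteq> {1..r}" "X \<noteq> {}" using E(3) \<open>X \<in> E\<close> by (auto simp: partition_on_def)
      ultimately show False by fastforce
    qed
    then show ?thesis by blast
  qed
  have split: "{1..n + r} = {1..r} \<union> {Suc r..n + r}" "{1..r} \<inter> {Suc r..n + r} = {}" by auto
  have join: "partition_on {1..n + r} (Q \<union> E)" if "Q \<in> Parts" for Q
  proof -
    have Q: "partition_on {Suc r..n + r} Q" using that by (simp add: Parts_def)
    have "\<Union>Q \<inter> \<Union>E = {}"
      using split(2) partition_onD1[OF Q] partition_onD1[OF E(3)] by (simp add: Int_commute)
    then have "disjoint (Q \<union> E)"
      by (intro disjoint_union partition_onD2[OF Q] partition_onD2[OF E(3)])
    then show ?thesis
      using Q E(3) split(1) by (simp add: partition_on_def Un_commute)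
  qed
  have rest: "P - E \<in> Parts" if P: "partition_on {1..n + r} P" "E \<subseteq> P" for P
  proof -
    have "\<Union>P = \<Union>E \<union> \<Union>(P - E)" using P(2) by blast
    then have "{1..r} \<union> \<Union>(P - E) = {1..r} \<union> {Suc r..n + r}"
      using P(1) E(3) split(1) by (simp add: partition_on_def)
    moreover have "{1..r} \<inter> \<Union>(P - E) = {}"
    proof -
      have "X \<inter> Y = {}" if "X \<in> E" "Y \<in> P - E" for X Y
        using disjointD[OF partition_onD2[OF P(1)], of X Y] P(2) that by blast
      then show ?thesis unfolding partition_onD1[OF E(3)] by blast
    qed
    ultimately have "\<Union>(P - E) = {Suc r..n + r}" using split(2) by blast
    moreover have "disjoint (P - E)" "{} \<notin> P - E"
      using P(1) by (auto simp: partition_on_def disjoint_def)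
    ultimately show ?thesis by (simp add: Parts_def partition_on_def)
  qed
  have le: "card Q \<le> n" if "Q \<in> Parts" for Q
  proof -
    have Q: "partition_on {Suc r..n + r} Q" using that by (simp add: Parts_def)
    then have blocks: "finite X" "X \<noteq> {}" if "X \<in> Q" for X
      using that by (auto simp: partition_on_def intro: finite_subset[of X "{Suc r..n + r}"])
    then have "card Q \<le> (\<Sum>X\<in>Q. card X)"
      using sum_mono[of Q "\<lambda>_. 1" card] by (simp add: Suc_le_eq card_gt_0_iff)
    also have "\<dots> = n" using product_partition[OF Q] blocks by simp
    finally show ?thesis .
  qed
  have mem: "(P, pl, M) \<in> configs r l n \<longleftrightarrow>
      partition_on {1..n + r} P \<and> E \<subseteq> P \<and> card (P - E) \<le> n \<and> (pl, M) \<in> placements (P - E) {1..l} E"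
    for P pl M
    unfolding configs_def configs_k_def placements_def section_pairs_def Let_def E_def by auto
  have "configs r l n = (\<lambda>(Q, pl, M). (Q \<union> E, pl, M)) ` (SIGMA Q:Parts. placements Q {1..l} E)"
  proof (intro equalityI subsetI)
    fix c assume c: "c \<in> configs r l n"
    obtain P pl M where "c = (P, pl, M)" by (metis surj_pair)
    with c mem rest show "c \<in> (\<lambda>(Q, pl, M). (Q \<union> E, pl, M)) ` (SIGMA Q:Parts. placements Q {1..l} E)"
      by (intro image_eqI[of _ _ "(P - E, pl, M)"]) auto
  next
    fix c assume "c \<in> (\<lambda>(Q, pl, M). (Q \<union> E, pl, M)) ` (SIGMA Q:Parts. placements Q {1..l} E)"
    then obtain Q pl M where c: "Q \<in> Parts" "(pl, M) \<in> placements Q {1..l} E" "c = (Q \<union> E, pl, M)"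
      by auto
    moreover have "Q \<union> E - E = Q" using Q_E[OF c(1)] by blast
    ultimately show "c \<in> configs r l n" using join le by (simp add: mem)
  qed
  moreover have "inj_on (\<lambda>(Q, pl, M). (Q \<union> E, pl, M)) (SIGMA Q:Parts. placements Q {1..l} E)"
  proof (rule inj_onI, clarsimp)
    fix Q Q' assume "Q \<in> Parts" "Q' \<in> Parts" "Q \<union> E = Q' \<union> E"
    with Q_E[of Q] Q_E[of Q'] show "Q = Q'" by blast
  qed
  ultimately have "card (configs r l n) = (\<Sum>Q\<in>Parts. card (placements Q {1..l} E))"
    using fin finQ E(2) by (simp add: card_image finite_placements)
  then show ?thesis
    using finQ E by (simp add: card_placements Parts_def)
qed

lemma sum_num_placements_partition_on_insert:
  assumes "finite A" "a \<notin> A"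
  shows "(\<Sum>P | partition_on (insert a A) P. num_placements l r (card P))
    = r * (\<Sum>P | partition_on A P. num_placements l r (card P)) + l * (\<Sum>P | partition_on A P. num_placements l (r + 2) (card P))"
  using sum_card_partition_on_insert[OF assms, of "num_placements l r"]
  by (simp only: of_nat_id num_placements_shift sum.distrib sum_distrib_left)

text \<open>The induction needs \<open>r\<close> arbitrary, since the step passes from \<open>r\<close> to \<open>r + 2\<close>.\<close>

lemma sum_num_placements_partition_on:
  assumes "finite A"
  shows "real (\<Sum>P | partition_on A P. num_placements l r (card P))
    = (\<Sum>k=0..card A. whitney2 2 r (card A) k * real l ^ k)"
  using assms
proof (induction A arbitrary: r rule: finite_induct)
  case empty
  then show ?case by (simp add: partition_on_empty whitney2_0)
next
  case (insert a A)
  have card: "card (insert a A) = Suc (card A)" using insert.hyps by simp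
  have "real (\<Sum>P | partition_on (insert a A) P. num_placements l r (card P))
      = real r * real (\<Sum>P | partition_on A P. num_placements l r (card P))
        + real l * real (\<Sum>P | partition_on A P. num_placements l (r + 2) (card P))"
    by (simp only: sum_num_placements_partition_on_insert[OF insert.hyps] of_nat_add of_nat_mult)
  also have "\<dots> = (\<Sum>k=0..card (insert a A). whitney2 2 r (card (insert a A)) k * real l ^ k)"
    by (simp only: insert.IH card whitney2_poly_Suc[of 2, OF zero_less_numeral])
  finally show ?case .
qed

theorem theorem4p6:
  fixes n r l :: nat
  assumes "l \<ge> 1"
  shows "real (B_tilde r l n) = (\<Sum>k=0..n. whitney2 2 r n k * real l ^ k)"
  using sum_num_placements_partition_on[of "{Suc r..n + r}" l r] unfolding B_tilde_def card_configs by simp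

end
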